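(* Let $\{\mathcal{B}_k\}_{k\in K}$ be a (finite) family of mutually unbiased bases in $\mathbb{F}^m$, let $s\le |K|$, and let $\mathbb{S}_1,\dots,\mathbb{S}_s$ be block designs on $\{1,\dots,m\}$ with parameters $(m,l_1,\lambda_1),\dots,(m,l_s,\lambda_s)$ respectively, where $l_1,\dots,l_s$ are pairwise distinct and $1\le l_i\le m-1$. Let $\{A_1,\dots,A_s\}$ be any partition of $K$ (into nonempty sets), and for each $i\in\{1,\dots,s\}$ let $\mathcal{P}_i=\{P^{\mathcal{B}_k}_{\mathcal{J}}: k\in A_i,\ \mathcal{J}\in\mathbb{S}_i\}$ be the corresponding family of coordinate projections of rank $l_i$. If for each $i$ the collection $\mathbb{S}_i$ is $l_i^2/m$-cohesive, and $\sum_{i=1}^{s}|\mathbb{S}_i||A_i|>d_{\mathbb{F}^m}+1$, then the union of the families $\mathcal{P}_1,\dots,\mathcal{P}_s$ is a tight, optimally spread packing with mixture $s$ for $\mathbb{F}^m$.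
   Context: $\mathbb{F}$ is $\mathbb{R}$ or $\mathbb{C}$; $d_{\mathbb{R}^m}=\frac{m(m+1)}{2}-1$ and $d_{\mathbb{C}^m}=m^2-1$. A packing in $\mathbb{F}^m$ is a finite sequence of $m\times m$ orthogonal projections. Its mixture is the number of different ranks occurring among its elements. It is tight if the sum of its elements is a (positive) scalar multiple of the identity $I_m$. Embedded vectors: for an orthogonal projection $P$ on $\mathbb{F}^m$ of rank $l$, $1\le l\le m-1$, put $v_P=\frac{1}{r_l}\left(P-\frac{l}{m}I_m\right)$ with $r_l=\sqrt{l(m-l)/m}$, a unit vector in the real inner product space of traceless symmetric/Hermitian $m\times m$ matrices with $\langle A,B\rangle=\operatorname{tr}(AB)$, which is identified isometrically with $\mathbb{R}^{d_{\mathbb{F}^m}}$. Let $\mathcal{K}_l$ be the set of all $v_P$ with $P$ of rank $l$. A packing $\{P_i\}_{i=1}^n$ with $\operatorname{rank}P_i=l_i$ is optimally spread if $\max_{i\ne j}\langle v_{P_i},v_{P_j}\rangle=\min_{(u_1,\dots,u_n)\in\mathcal{K}_{l_1}\times\cdots\times\mathcal{K}_{l_n}}\max_{i\neq j}\langle u_i,u_j\rangle$. Orthonormal bases $\{b_j\}_{j=1}^m,\{b'_j\}_{j=1}^m$ of $\mathbb{F}^m$ are mutually unbiased if $|\langle b_j,b'_{j'}\rangle|^2=\frac1m$ for all $j,j'$; a family of orthonormal bases is a set of mutually unbiased bases if every two distinct members are mutually unbiased. For an orthonormal basis $\mathcal{B}=\{b_j\}_{j=1}^m$ and $\mathcal{J}\subset\{1,\dots,m\}$,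 the coordinate projection is $P^{\mathcal{B}}_{\mathcal{J}}=\sum_{j\in\mathcal{J}}b_jb_j^*$. A $t$-$(m,l,\lambda)$ block design is a nonempty collection (set) $\mathbb{S}$ of subsets of $\{1,\dots,m\}$, called blocks, each of cardinality $l$, such that every $t$-element subset of $\{1,\dots,m\}$ is contained in exactly $\lambda$ blocks and each element of $\{1,\dots,m\}$ occurs in exactly $r$ blocks for some $r$. An $(m,l,\lambda)$ block design is a $t$-$(m,l,\lambda)$ block design for some $t\geq 1$ ($t$ may differ among the $\mathbb{S}_i$). A collection $\mathbb{S}$ of subsets of $\{1,\dots,m\}$ of equal cardinality is $c$-cohesive ($c>0$) if $|\mathcal{J}\cap\mathcal{J}'|\le c$ for all distinct $\mathcal{J},\mathcal{J}'\in\mathbb{S}$. *)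

theory Defs
  imports "HOL-Analysis.Analysis"
begin

text \<open>
  The scalar field F is a parameter of type complex set, with the two admissible values
  \<open>\<real>\<close> and \<open>UNIV\<close>. Thus F^m consists of the vectors of type complex ^ 'm
  with entries in F (m = CARD('m), and 'm plays the role of the index set {1,...,m});
  for F = \<open>\<real>\<close> these are the real vectors, and likewise for matrices.
  The rank of a matrix with real entries is the same over the reals and over the complex numbers.
\<close>

definition scalar_field :: "complex set \<Rightarrow> bool" where
  "scalar_field F \<longleftrightarrow> F = \<real> \<or> F = UNIV"

definition vectors_over :: "complex set \<Rightarrow> (complex ^ 'm) set" where
  "vectors_over F = {x. \<forall>i. x $ i \<in> F}"

definition matrices_over :: "complex set \<Rightarrow> (complex ^ 'm ^ 'm) set" where
  "matrices_over F = {A. \<forall>i j. A $ i $ j \<in> F}"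

definition packing_dim :: "complex set \<Rightarrow> nat \<Rightarrow> nat" where
  "packing_dim F m = (if F = \<real> then m * (m + 1) div 2 - 1 else m\<^sup>2 - 1)"

definition cinner :: "complex ^ 'm \<Rightarrow> complex ^ 'm \<Rightarrow> complex" where
  "cinner x y = (\<Sum>i\<in>UNIV. x $ i * cnj (y $ i))"

definition ctranspose :: "complex ^ 'm ^ 'm \<Rightarrow> complex ^ 'm ^ 'm" where
  "ctranspose A = map_matrix cnj (transpose A)"

definition outer_product :: "complex ^ 'm \<Rightarrow> complex ^ 'm \<Rightarrow> complex ^ 'm ^ 'm" where
  "outer_product x y = (\<chi> i j. x $ i * cnj (y $ j))"


definition orth_projection :: "complex set \<Rightarrow> complex ^ 'm ^ 'm \<Rightarrow> bool" where
  "orth_projection F P \<longleftrightarrow> P \<in> matrices_over F \<and> P ** P = P \<and> ctranspose P = P"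

definition packing :: "complex set \<Rightarrow> (complex ^ 'm ^ 'm) list \<Rightarrow> bool" where
  "packing F Ps \<longleftrightarrow> (\<forall>P\<in>set Ps. orth_projection F P)"

definition mixture :: "(complex ^ 'm ^ 'm) list \<Rightarrow> nat" where
  "mixture Ps = card (rank ` set Ps)"

definition tight :: "(complex ^ 'm ^ 'm) list \<Rightarrow> bool" where
  "tight Ps \<longleftrightarrow> (\<exists>c::real. c > 0 \<and> sum_list Ps = c *\<^sub>R mat 1)"

definition embed_projection :: "complex ^ 'm ^ 'm \<Rightarrow> complex ^ 'm ^ 'm" where
  "embed_projection P =
    (let l = real (rank P); m = real CARD('m)
     in (1 / sqrt (l * (m - l) / m)) *\<^sub>R (P - (l / m) *\<^sub>R mat 1))"

definition embedded_projections :: "complex set \<Rightarrow> nat \<Rightarrow> (complex ^ 'm ^ 'm) set" where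
  "embedded_projections F l = embed_projection ` {P. orth_projection F P \<and> rank P = l}"

text \<open>
  The space of traceless symmetric or Hermitian matrices is used directly, with its own inner
  product, in place of an isometric copy of it. For such matrices the trace of AB is real, so
  taking the real part only converts the type.
\<close>

definition trace_inner :: "complex ^ 'm ^ 'm \<Rightarrow> complex ^ 'm ^ 'm \<Rightarrow> real" where
  "trace_inner A B = Re (trace (A ** B))"

definition coherence :: "(complex ^ 'm ^ 'm) list \<Rightarrow> real" where
  "coherence us =
    Max {trace_inner (us ! i) (us ! j) | i j. i < length us \<and> j < length us \<and> i \<noteq> j}"

text \<open>
  The embedded vectors of the packing are themselves an element of the product of the sets of
  embedded projections, so their coherence is the minimum over this product iff
  they are a minimizer.
\<close>

definition optimally_spread :: "complex set \<Rightarrow> (complex ^ 'm ^ 'm) list \<Rightarrow> bool" where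
  "optimally_spread F Ps \<longleftrightarrow>
    packing F Ps \<and> (\<forall>P\<in>set Ps. 1 \<le> rank P \<and> rank P \<le> CARD('m) - 1) \<and>
    is_arg_min coherence
      (\<lambda>us. list_all2 (\<lambda>u P. u \<in> embedded_projections F (rank P)) us Ps)
      (map embed_projection Ps)"


text \<open>
  A basis is indexed by 'm itself. Since m orthonormal vectors in F^m are automatically a basis,
  no spanning condition is stated.
\<close>

definition orthonormal_basis :: "complex set \<Rightarrow> ('m \<Rightarrow> complex ^ 'm) \<Rightarrow> bool" where
  "orthonormal_basis F b \<longleftrightarrow>
    (\<forall>j. b j \<in> vectors_over F) \<and> (\<forall>i j. cinner (b i) (b j) = (if i = j then 1 else 0))"

definition mutually_unbiased :: "('m \<Rightarrow> complex ^ 'm) \<Rightarrow> ('m \<Rightarrow> complex ^ 'm) \<Rightarrow> bool" where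
  "mutually_unbiased b b' \<longleftrightarrow> (\<forall>j j'. (cmod (cinner (b j) (b' j')))\<^sup>2 = 1 / real CARD('m))"

definition mutually_unbiased_bases ::
    "complex set \<Rightarrow> 'k set \<Rightarrow> ('k \<Rightarrow> 'm \<Rightarrow> complex ^ 'm) \<Rightarrow> bool" where
  "mutually_unbiased_bases F K B \<longleftrightarrow>
    (\<forall>k\<in>K. orthonormal_basis F (B k)) \<and> pairwise (\<lambda>k k'. mutually_unbiased (B k) (B k')) K"

definition coord_projection :: "('m \<Rightarrow> complex ^ 'm) \<Rightarrow> 'm set \<Rightarrow> complex ^ 'm ^ 'm" where
  "coord_projection b J = (\<Sum>j\<in>J. outer_product (b j) (b j))"


definition t_block_design :: "nat \<Rightarrow> nat \<Rightarrow> nat \<Rightarrow> 'm::finite set set \<Rightarrow> bool" where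
  "t_block_design t l lam S \<longleftrightarrow>
    S \<noteq> {} \<and> (\<forall>J\<in>S. card J = l) \<and>
    (\<forall>T. card T = t \<longrightarrow> card {J\<in>S. T \<subseteq> J} = lam) \<and>
    (\<exists>r. \<forall>j. card {J\<in>S. j \<in> J} = r)"

definition block_design :: "nat \<Rightarrow> nat \<Rightarrow> 'm::finite set set \<Rightarrow> bool" where
  "block_design l lam S \<longleftrightarrow> (\<exists>t\<ge>1. t_block_design t l lam S)"

definition cohesive :: "real \<Rightarrow> 'm::finite set set \<Rightarrow> bool" where
  "cohesive c S \<longleftrightarrow>
    c > 0 \<and> (\<exists>l. \<forall>J\<in>S. card J = l) \<and>
    (\<forall>J\<in>S. \<forall>J'\<in>S. J \<noteq> J' \<longrightarrow> real (card (J \<inter> J')) \<le> c)"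

end

theory Submission
  imports Defs
begin

text \<open>
  Write \<open>d\<close> for the dimension of the space of traceless symmetric or Hermitian matrices. The
  inner product of two embedded projections has the sign of \<open>tr (P Q) - l l' / m\<close>, where \<open>l\<close> and \<open>l'\<close>
  are the ranks (\<open>inner_embed_projection\<close>). For coordinate projections of unbiased bases, every pair of
  basis vectors contributes \<open>1 / m\<close> to \<open>tr (P Q)\<close>, so the embedded vectors are orthogonal. For two
  coordinate projections of the same basis, \<open>tr (P Q)\<close> is the size of the intersection of the two
  blocks. Both blocks come from the same design, because each basis is assigned to one design only,
  and cohesiveness says exactly that the inner product is not positive. Hence the packing has
  coherence at most 0.

  On the other hand, a space of dimension \<open>d\<close> contains at most \<open>d + 1\<close> vectors with pairwise
  negative inner products (\<open>obtuse_card_le_dim\<close>). The packing has more elements than that, so the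
  coherence is at least 0 for every competitor (\<open>coherence_nonneg\<close>), and the packing is a
  minimizer. Counting the elements of the packing requires that the coordinate projections are pairwise
  distinct, which follows from the same values of \<open>tr (P Q)\<close>.

  Tightness holds because in a block design every point lies in the same number of blocks: for each
  basis, the projections of one design sum to a multiple of the identity
  (\<open>sum_coord_projection_regular\<close>). The mixture is \<open>s\<close> because the rank of a coordinate projection is
  the size of its block, which is read off from its trace (\<open>trace_idempotent_eq_rank\<close>).
\<close>

section \<open>Obtuse systems of vectors\<close>

text \<open>
  Separate the positive from the negative coefficients of a linear relation. This writes one
  vector \<open>w\<close> in two ways as a nonnegative combination, over disjoint index sets; obtuseness
  gives \<open>w \<bullet> w \<le> 0\<close>, so \<open>w = 0\<close>. But a nonnegative combination of vectors of the open half
  space given by \<open>z\<close> vanishes only if all its coefficients do.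
\<close>
lemma obtuse_half_space_independent:
  fixes X :: "'a::euclidean_space set"
  assumes fin: "finite X"
    and obtuse: "\<And>x y. x \<in> X \<Longrightarrow> y \<in> X \<Longrightarrow> x \<noteq> y \<Longrightarrow> x \<bullet> y < 0"
    and half: "\<And>x. x \<in> X \<Longrightarrow> x \<bullet> z < 0"
  shows "independent X"
proof -
  \<comment> \<open>It suffices to exclude positive coefficients, because a relation can be negated.\<close>
  have nonpos: "c y \<le> 0" if c: "(\<Sum>x\<in>X. c x *\<^sub>R x) = 0" and y: "y \<in> X" for c :: "'a \<Rightarrow> real" and y
  proof (rule ccontr)
    assume "\<not> c y \<le> 0"
    define U where "U = {x \<in> X. 0 < c x}"
    define w where "w = (\<Sum>x\<in>U. c x *\<^sub>R x)"
    have U: "finite U" "U \<subseteq> X" "y \<in> U"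
      using fin y \<open>\<not> c y \<le> 0\<close> by (auto simp: U_def)
    have w': "w = (\<Sum>x\<in>X - U. (- c x) *\<^sub>R x)"
      using c sum.subset_diff[OF U(2) fin, of "\<lambda>x. c x *\<^sub>R x"]
      by (simp add: w_def sum_negf add_eq_0_iff)
    have "w \<bullet> w = (\<Sum>x\<in>X - U. \<Sum>x'\<in>U. (- c x) * c x' * (x' \<bullet> x))"
      by (subst (2) w', simp only: w_def inner_sum_left inner_sum_right) (simp add: algebra_simps)
    also have "\<dots> \<le> 0"
      by (intro sum_nonpos mult_nonneg_nonpos mult_nonneg_nonneg less_imp_le[OF obtuse])
         (use U in \<open>auto simp: U_def\<close>)
    finally have "w = 0" by (meson inner_ge_zero inner_eq_zero_iff order_antisym)
    moreover have "w \<bullet> z < 0"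
      using sum_strict_mono[of U "\<lambda>x. c x * (x \<bullet> z)" "\<lambda>_. 0"] U half
      by (auto simp: w_def inner_sum_left U_def mult_pos_neg)
    ultimately show False by simp
  qed
  show ?thesis
    unfolding independent_explicit
  proof (intro conjI allI impI ballI)
    fix c y assume c: "(\<Sum>x\<in>X. c x *\<^sub>R x) = 0" and y: "y \<in> X"
    have "(\<Sum>x\<in>X. (- c x) *\<^sub>R x) = 0" using c by (simp add: sum_negf)
    then show "c y = 0" using nonpos[OF c y] nonpos[of "\<lambda>x. - c x", OF _ y] by simp
  qed (rule fin)
qed

text \<open>
  This is Rankin's bound: at most \<open>d + 1\<close> vectors of a \<open>d\<close>-dimensional space have pairwise
  negative inner products. Any one of them, \<open>z\<close>, has the others in the half space opposite to it,
  so the others are independent. The ambient space here is \<open>V\<close>, and the vectors live in the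
  hyperplane orthogonal to \<open>e\<close>; the vector \<open>e\<close> then takes the place of \<open>z\<close> in an independent
  set. In this form the dimension of the hyperplane never has to be computed.
\<close>
lemma obtuse_card_le_dim:
  fixes X V :: "'a::euclidean_space set"
  assumes fin: "finite X"
    and obtuse: "\<And>x y. x \<in> X \<Longrightarrow> y \<in> X \<Longrightarrow> x \<noteq> y \<Longrightarrow> x \<bullet> y < 0"
    and orth: "\<And>x. x \<in> X \<Longrightarrow> e \<bullet> x = 0"
    and e: "e \<noteq> 0" and sub: "insert e X \<subseteq> V"
  shows "card X \<le> dim V"
proof (cases "X = {}")
  case False
  then obtain z where z: "z \<in> X" by blast
  have ind: "independent (X - {z})"
    by (rule obtuse_half_space_independent[where z = z]) (use fin obtuse z in auto)
  have e_span: "e \<notin> span (X - {z})"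
    using orthogonal_to_span[of e "X - {z}" e] orth e by (auto simp: orthogonal_def)
  have "e \<notin> X - {z}" using e_span span_base by metis
  have "independent (insert e (X - {z}))" by (rule independent_insertI[OF e_span ind])
  then have "card (insert e (X - {z})) \<le> dim V"
    using sub by (intro independent_card_le_dim) auto
  then show ?thesis
    using \<open>e \<notin> X - {z}\<close> fin by (simp add: card.remove[OF fin z])
qed auto

section \<open>Trace and rank of an idempotent matrix\<close>

text \<open>
  The trace can be computed as \<open>\<Sum>b\<in>D. \<phi>\<^sub>b (M b)\<close> for any basis \<open>D\<close>, where \<open>\<phi>\<^sub>b\<close> is the coordinate at
  \<open>b\<close>. Let \<open>D\<close> extend a basis \<open>C\<close> of the range of \<open>M\<close>. A member of \<open>C\<close> is fixed by \<open>M\<close> and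
  contributes 1; for the other members \<open>M b\<close> lies in the span of \<open>C\<close>, and the contribution is 0.
\<close>
lemma trace_idempotent_eq_dim_columns:
  fixes M :: "'a::field^'n^'n"
  assumes idem: "M ** M = M"
  shows "trace M = of_nat (vec.dim (columns M))"
proof -
  obtain C where C: "C \<subseteq> columns M" "vec.independent C" "columns M \<subseteq> vec.span C"
      "card C = vec.dim (columns M)"
    using vec.basis_exists by blast
  obtain D where D: "C \<subseteq> D" "vec.independent D" "UNIV \<subseteq> vec.span D"
    using vec.maximal_independent_subset_extend[of C UNIV] C(2) by auto
  have span: "x \<in> vec.span D" for x using D(3) by blast
  have finD: "finite D" using D(2) by (rule vec.finiteI_independent)
  have MC: "M *v x \<in> vec.span C" for x
    using matrix_vector_mult_in_columnspace_gen[of M x] C(3)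
    by (meson subsetD vec.span_minimal vec.subspace_span)
  have col: "M *v axis i 1 = column i M" for i
    by (simp add: vec_eq_iff matrix_vector_mult_def axis_def column_def if_distrib cong: if_cong)
  let ?\<phi> = "vec.representation D"
  have fix_C: "M *v x = x" if x: "x \<in> C" for x
  proof -
    obtain i where "x = column i M" using x C(1) by (auto simp: columns_def)
    then have "x = M *v axis i 1" by (simp add: col)
    then show ?thesis by (simp add: matrix_vector_mul_assoc idem)
  qed
  have expand: "(\<Sum>b\<in>D. ?\<phi> x b *s b) = x" for x
    using vec.sum_representation_eq[OF D(2) span finD order_refl] .
  have "trace M = (\<Sum>i\<in>UNIV. (M *v (\<Sum>b\<in>D. ?\<phi> (axis i 1) b *s b)) $ i)"
    by (simp add: expand trace_def col column_def)
  also have "\<dots> = (\<Sum>i\<in>UNIV. \<Sum>b\<in>D. ?\<phi> (axis i 1) b * (M *v b) $ i)"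
    by (simp add: vec.sum vec.scale)
  also have "\<dots> = (\<Sum>b\<in>D. \<Sum>i\<in>UNIV. (M *v b) $ i * ?\<phi> (axis i 1) b)"
    by (subst sum.swap) (simp add: mult.commute)
  also have "\<dots> = (\<Sum>b\<in>D. ?\<phi> (M *v b) b)"
  proof (rule sum.cong[OF refl])
    fix b
    have "?\<phi> (\<Sum>i\<in>UNIV. (M *v b) $ i *s axis i 1) b = (\<Sum>i\<in>UNIV. (M *v b) $ i * ?\<phi> (axis i 1) b)"
      by (simp add: vec.representation_sum vec.representation_scale D(2) span)
    then show "(\<Sum>i\<in>UNIV. (M *v b) $ i * ?\<phi> (axis i 1) b) = ?\<phi> (M *v b) b"
      by (simp add: basis_expansion)
  qed
  also have "\<dots> = (\<Sum>b\<in>D. if b \<in> C then 1 else 0)"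
  proof (rule sum.cong[OF refl])
    fix b assume b: "b \<in> D"
    show "?\<phi> (M *v b) b = (if b \<in> C then 1 else 0)"
    proof (cases "b \<in> C")
      case True
      then show ?thesis using fix_C[OF True] vec.representation_basis[OF D(2) b] by simp
    next
      case False
      have "?\<phi> (M *v b) = vec.representation C (M *v b)"
        using vec.representation_extend[OF D(2) MC D(1)] .
      then show ?thesis using False vec.representation_ne_zero[of C "M *v b" b] by auto
    qed
  qed
  also have "\<dots> = of_nat (card C)"
    using D(1) finD by (simp add: sum.If_cases Int_absorb1)
  finally show ?thesis by (simp add: C(4))
qed

text \<open>
  Since \<^const>\<open>rank\<close> is the dimension of the row space, the column version is used for the
  transpose.
\<close>
lemma trace_idempotent_eq_rank:
  fixes P :: "'a::field^'n^'n"
  assumes "P ** P = P"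
  shows "trace P = of_nat (rank P)"
proof -
  have "transpose P ** transpose P = transpose P"
    using assms by (metis matrix_transpose_mul)
  from trace_idempotent_eq_dim_columns[OF this] show ?thesis
    by (simp add: row_rank_def_gen columns_transpose) (simp add: trace_def transpose_def)
qed


section \<open>The real Euclidean space of Hermitian matrices\<close>

definition hermitian_over :: "complex set \<Rightarrow> (complex ^ 'm ^ 'm) set" where
  "hermitian_over F = {A \<in> matrices_over F. ctranspose A = A}"

lemma hermitian_entry: "A \<in> hermitian_over F \<Longrightarrow> A $ i $ j = cnj (A $ j $ i)"
  by (auto simp: hermitian_over_def ctranspose_def map_matrix_def transpose_def vec_eq_iff)

text \<open>
  On Hermitian matrices the trace form is the standard real inner product of matrices, which makes
  the theory of real Euclidean spaces applicable to embedded projections.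
\<close>
lemma trace_inner_hermitian:
  assumes "B \<in> hermitian_over F"
  shows "trace_inner A B = A \<bullet> B"
proof -
  have "Re (A $ i $ k * B $ k $ i) = A $ i $ k \<bullet> B $ i $ k" for i k
    by (subst hermitian_entry[OF assms]) (simp add: inner_complex_def)
  then show ?thesis
    by (simp add: trace_inner_def trace_def matrix_matrix_mult_def inner_vec_def Re_sum del: times_complex.sel)
qed

lemma subspace_hermitian_over: "scalar_field F \<Longrightarrow> subspace (hermitian_over F)"
  by (auto simp: scalar_field_def subspace_def hermitian_over_def matrices_over_def ctranspose_def map_matrix_def
      transpose_def vec_eq_iff scaleR_conv_of_real[where 'a=complex])

text \<open>
  Multiplication by \<open>\<i>\<close> turns the Hermitian matrices into the skew-Hermitian ones, and only 0 is
  both. So twice the dimension is at most the real dimension \<open>2 m\<^sup>2\<close> of the space of all matrices.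
\<close>
lemma dim_hermitian_le: "dim (hermitian_over F :: (complex^'m^'m) set) \<le> CARD('m)\<^sup>2"
proof -
  let ?H = "hermitian_over UNIV :: (complex^'m^'m) set"
  define f :: "complex^'m^'m \<Rightarrow> complex^'m^'m" where "f A = (\<chi> i j. \<i> * A $ i $ j)" for A
  have f: "linear f" "inj f"
    by (auto intro!: linearI injI simp: f_def vec_eq_iff algebra_simps)
  have H: "subspace ?H" by (rule subspace_hermitian_over) (simp add: scalar_field_def)
  have "?H \<inter> f ` ?H \<subseteq> {0}"
  proof clarify
    fix A assume A: "A \<in> ?H" and fA: "f A \<in> ?H"
    have "A $ i $ j = 0" for i j
      using hermitian_entry[OF fA, of i j] hermitian_entry[OF A, of i j] by (simp add: f_def)
    then show "f A = 0" by (simp add: f_def vec_eq_iff)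
  qed
  then have "dim (?H \<inter> f ` ?H) = 0" by simp
  moreover have "dim (f ` ?H) = dim ?H"
    by (rule dim_image_eq) (use f in \<open>auto intro: inj_on_subset\<close>)
  ultimately have "dim ?H + dim ?H = dim {x + y |x y. x \<in> ?H \<and> y \<in> f ` ?H}"
    using dim_sums_Int[OF H linear_subspace_image[OF f(1) H]] by linarith
  also have "\<dots> \<le> DIM(complex^'m^'m)" by (rule dim_subset_UNIV)
  finally have "dim ?H + dim ?H \<le> DIM(complex^'m^'m)" .
  moreover have "dim (hermitian_over F :: (complex^'m^'m) set) \<le> dim ?H"
    by (rule dim_subset) (auto simp: hermitian_over_def matrices_over_def)
  ultimately show ?thesis by (simp add: power2_eq_square)
qed

text \<open>
  These sets index the diagonal and the off-diagonal entries of a symmetric matrix, without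
  reference to an ordering of the index type.
\<close>
lemma card_one_or_two_subsets:
  "card {T :: 'm::finite set. card T = 1 \<or> card T = 2} = CARD('m) * (CARD('m) + 1) div 2"
proof -
  have "card {T :: 'm set. card T = 1 \<or> card T = 2} = card ({T :: 'm set. card T = 1} \<union> {T. card T = 2})"
    by (simp add: Collect_disj_eq)
  also have "\<dots> = (CARD('m) choose 1) + (CARD('m) choose 2)"
    using n_subsets[of "UNIV :: 'm set"] by (subst card_Un_disjoint) auto
  also have "\<dots> = Suc (CARD('m)) choose 2"
    by (simp add: numeral_2_eq_2)
  finally show ?thesis by (simp add: choose_two mult.commute)
qed

lemma dim_symmetric_le:
  "dim (hermitian_over \<real> :: (complex^'m^'m) set) \<le> CARD('m) * (CARD('m) + 1) div 2"
proof -
  define E :: "'m set \<Rightarrow> complex^'m^'m" where "E T = (\<chi> i j. if {i, j} = T then 1 else 0)" for T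
  let ?\<T> = "{T :: 'm set. card T = 1 \<or> card T = 2}"
  have "A \<in> span (E ` ?\<T>)" if A: "A \<in> hermitian_over \<real>" for A
  proof -
    \<comment> \<open>The entry of \<open>A\<close> at either of the positions \<open>(i, j)\<close> with \<open>T = {i, j}\<close>; by symmetry they agree.\<close>
    define a where "a T = (SOME r. \<exists>i j. T = {i, j} \<and> r = Re (A $ i $ j))" for T
    have real: "A $ i $ j = of_real (Re (A $ i $ j))" for i j
      using A by (auto simp: hermitian_over_def matrices_over_def)
    have sym: "A $ i $ j = A $ j $ i" for i j
      using hermitian_entry[OF A, of i j] by (metis complex_cnj_complex_of_real real)
    have a: "of_real (a {i, j}) = A $ i $ j" for i j
    proof -
      have "\<exists>i' j'. {i, j} = {i', j'} \<and> a {i, j} = Re (A $ i' $ j')"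
        unfolding a_def by (rule someI_ex) blast
      then show ?thesis using real sym by (metis doubleton_eq_iff)
    qed
    have "A $ i $ j = (\<Sum>T\<in>?\<T>. a T *\<^sub>R E T) $ i $ j" for i j
    proof -
      have "{i, j} \<in> ?\<T>" by (cases "i = j") auto
      then have "A $ i $ j = (\<Sum>T\<in>?\<T>. if T = {i, j} then of_real (a T) else 0)"
        by (simp add: a sum.delta)
      also have "\<dots> = (\<Sum>T\<in>?\<T>. a T *\<^sub>R E T $ i $ j)"
        by (intro sum.cong) (auto simp: E_def scaleR_conv_of_real)
      finally show ?thesis by simp
    qed
    then have "A = (\<Sum>T\<in>?\<T>. a T *\<^sub>R E T)" by (simp only: vec_eq_iff simp_thms)
    also have "\<dots> \<in> span (E ` ?\<T>)"
      by (intro span_sum span_scale span_base imageI)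
    finally show ?thesis .
  qed
  then have "dim (hermitian_over \<real> :: (complex^'m^'m) set) \<le> card (E ` ?\<T>)"
    by (intro dim_le_card) auto
  also have "\<dots> \<le> card ?\<T>" by (rule card_image_le) simp
  finally show ?thesis by (simp only: card_one_or_two_subsets)
qed

lemma dim_hermitian_over_le_packing_dim:
  "dim (hermitian_over F :: (complex^'m^'m) set) \<le> packing_dim F CARD('m) + 1"
proof (cases "F = \<real>")
  case True
  then show ?thesis using dim_symmetric_le[where 'm='m] by (simp add: packing_dim_def)
next
  case False
  then show ?thesis using dim_hermitian_le[of F, where 'm='m] by (simp add: packing_dim_def)
qed

section \<open>Embedded projections and their coherence\<close>

lemma hermitian_if_orth_projection: "orth_projection F P \<Longrightarrow> P \<in> hermitian_over F"
  by (simp add: orth_projection_def hermitian_over_def)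

lemma inner_mat_1: "mat 1 \<bullet> A = Re (trace A)" for A :: "complex^'m^'m"
proof -
  have "(mat 1 :: complex^'m^'m) $ i $ j \<bullet> A $ i $ j = (if j = i then Re (A $ i $ i) else 0)" for i j
    by (simp add: mat_def inner_complex_def)
  then show ?thesis by (simp add: inner_vec_def trace_def)
qed

lemma inner_mat_1_orth_projection:
  "orth_projection F P \<Longrightarrow> mat 1 \<bullet> P = real (rank P)"
  by (simp add: inner_mat_1 trace_idempotent_eq_rank orth_projection_def)

lemma mat_1_in_hermitian_over: "scalar_field F \<Longrightarrow> mat 1 \<in> hermitian_over F"
  by (auto simp: scalar_field_def hermitian_over_def matrices_over_def ctranspose_def map_matrix_def
      transpose_def mat_def vec_eq_iff)

lemma embed_projection_in_hermitian_over:
  assumes F: "scalar_field F" and P: "orth_projection F P"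
  shows "embed_projection P \<in> hermitian_over F"
  unfolding embed_projection_def Let_def
  by (intro subspace_scale subspace_diff subspace_hermitian_over[OF F] hermitian_if_orth_projection[OF P]
      mat_1_in_hermitian_over[OF F])

text \<open>
  Up to a nonnegative factor, the inner product of embedded projections measures by how much
  \<open>tr (P Q)\<close> exceeds the value \<open>rank P rank Q / m\<close>. Only its sign is needed, so the factor is left
  unspecified.
\<close>
lemma inner_embed_projection:
  fixes P Q :: "complex^'m^'m"
  assumes P: "orth_projection F P" and Q: "orth_projection F Q"
  obtains c where "0 \<le> c"
    "embed_projection P \<bullet> embed_projection Q = c * (P \<bullet> Q - real (rank P) * real (rank Q) / real CARD('m))"
proof -
  let ?m = "real CARD('m)"
  let ?c = "\<lambda>l. 1 / sqrt (l * (?m - l) / ?m)"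
  have rank_le: "real (rank R) \<le> ?m" for R :: "complex^'m^'m"
    using vec.dim_subset[OF subset_UNIV, of "rows R"] by (simp only: row_rank_def_gen vec_dim_card of_nat_le_iff)
  have "mat 1 \<bullet> (mat 1 :: complex^'m^'m) = ?m"
    by (simp add: inner_mat_1 trace_I)
  then have "embed_projection P \<bullet> embed_projection Q =
      (?c (rank P) * ?c (rank Q)) * (P \<bullet> Q - real (rank P) * real (rank Q) / ?m)"
    using inner_mat_1_orth_projection[OF P] inner_mat_1_orth_projection[OF Q]
    by (simp add: embed_projection_def Let_def inner_simps inner_commute[of P "mat 1"])
  then show thesis
    using rank_le[of P] rank_le[of Q] by (intro that[of "?c (rank P) * ?c (rank Q)"]) auto
qed

lemma mat_1_orthogonal_embed_projection:
  fixes P :: "complex^'m^'m"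
  assumes "orth_projection F P"
  shows "mat 1 \<bullet> embed_projection P = 0"
  using inner_mat_1_orth_projection[OF assms]
  by (simp add: embed_projection_def Let_def inner_simps inner_mat_1[of "mat 1"] trace_I)

lemma trace_inner_le_coherence:
  assumes "i < length us" "j < length us" "i \<noteq> j"
  shows "trace_inner (us ! i) (us ! j) \<le> coherence us"
proof -
  let ?S = "{trace_inner (us ! i) (us ! j) | i j. i < length us \<and> j < length us \<and> i \<noteq> j}"
  have "?S \<subseteq> (\<lambda>(i, j). trace_inner (us ! i) (us ! j)) ` ({..<length us} \<times> {..<length us})"
    by auto
  then have "finite ?S" by (rule finite_subset) simp
  then show ?thesis unfolding coherence_def by (rule Max_ge) (use assms in blast)
qed

lemma coherence_attained:
  assumes "2 \<le> length us"
  obtains i j where "i < length us" "j < length us" "i \<noteq> j" "coherence us = trace_inner (us ! i) (us ! j)"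
proof -
  let ?S = "{trace_inner (us ! i) (us ! j) | i j. i < length us \<and> j < length us \<and> i \<noteq> j}"
  have "?S \<subseteq> (\<lambda>(i, j). trace_inner (us ! i) (us ! j)) ` ({..<length us} \<times> {..<length us})"
    by auto
  then have "finite ?S" by (rule finite_subset) simp
  moreover have "trace_inner (us ! 0) (us ! 1) \<in> ?S"
    using assms by (intro CollectI exI[of _ 0] exI[of _ 1]) auto
  ultimately have "Max ?S \<in> ?S" by (intro Max_in) auto
  then show thesis using that unfolding coherence_def by blast
qed

text \<open>
  If the coherence were negative, the embedded vectors would be pairwise obtuse (in particular
  distinct) and orthogonal to the identity, and there are too many of them for that.
\<close>
lemma coherence_nonneg:
  fixes us :: "(complex^'m^'m) list"
  assumes F: "scalar_field F"
    and len: "length us > packing_dim F CARD('m) + 1"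
    and herm: "set us \<subseteq> hermitian_over F"
    and orth: "\<And>u. u \<in> set us \<Longrightarrow> mat 1 \<bullet> u = 0"
  shows "0 \<le> coherence us"
proof (rule ccontr)
  assume neg: "\<not> 0 \<le> coherence us"
  have obtuse: "us ! i \<bullet> us ! j < 0" if "i < length us" "j < length us" "i \<noteq> j" for i j
  proof -
    have "us ! j \<in> hermitian_over F" using herm that by auto
    from trace_inner_hermitian[OF this, of "us ! i"] show ?thesis
      using trace_inner_le_coherence[OF that] neg by linarith
  qed
  have "distinct us"
    unfolding distinct_conv_nth using obtuse by (metis inner_ge_zero not_le)
  then have "length us = card (set us)" by (simp add: distinct_card)
  also have "\<dots> \<le> dim (hermitian_over F :: (complex^'m^'m) set)"
  proof (rule obtuse_card_le_dim)
    show "x \<bullet> y < 0" if "x \<in> set us" "y \<in> set us" "x \<noteq> y" for x y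
      using that obtuse by (metis in_set_conv_nth)
    show "mat 1 \<noteq> (0 :: complex^'m^'m)" by (simp add: mat_def vec_eq_iff)
  qed (use herm orth mat_1_in_hermitian_over[OF F] in auto)
  also have "\<dots> \<le> packing_dim F CARD('m) + 1" by (rule dim_hermitian_over_le_packing_dim)
  finally show False using len by simp
qed

text \<open>
  With more than \<open>d + 1\<close> elements, no choice of embedded projections of the prescribed ranks has
  negative coherence. A packing whose coherence is at most 0 is therefore a minimizer.
\<close>
lemma optimally_spread_if_pairwise_obtuse:
  fixes Ps :: "(complex^'m^'m) list"
  assumes F: "scalar_field F" and pack: "packing F Ps"
    and rank: "\<And>P. P \<in> set Ps \<Longrightarrow> 1 \<le> rank P \<and> rank P \<le> CARD('m) - 1"
    and len: "length Ps > packing_dim F CARD('m) + 1"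
    and dist: "distinct Ps"
    and obtuse: "\<And>P Q. P \<in> set Ps \<Longrightarrow> Q \<in> set Ps \<Longrightarrow> P \<noteq> Q \<Longrightarrow>
      trace_inner P Q \<le> real (rank P) * real (rank Q) / real CARD('m)"
  shows "optimally_spread F Ps"
proof -
  let ?es = "map embed_projection Ps"
  have proj: "orth_projection F P" if "P \<in> set Ps" for P
    using pack that by (simp add: packing_def)
  have "coherence ?es \<le> 0"
  proof -
    obtain i j where ij: "i < length Ps" "j < length Ps" "i \<noteq> j"
      and coh: "coherence ?es = trace_inner (embed_projection (Ps ! i)) (embed_projection (Ps ! j))"
      using coherence_attained[of ?es] len by auto
    let ?P = "Ps ! i" and ?Q = "Ps ! j"
    have PQ: "?P \<in> set Ps" "?Q \<in> set Ps" "?P \<noteq> ?Q"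
      using ij dist by (auto simp: nth_eq_iff_index_eq)
    obtain c where c: "0 \<le> c" "embed_projection ?P \<bullet> embed_projection ?Q =
        c * (?P \<bullet> ?Q - real (rank ?P) * real (rank ?Q) / real CARD('m))"
      using inner_embed_projection proj PQ by metis
    have "?P \<bullet> ?Q \<le> real (rank ?P) * real (rank ?Q) / real CARD('m)"
      using obtuse[OF PQ] trace_inner_hermitian[OF hermitian_if_orth_projection[OF proj[OF PQ(2)]]]
      by simp
    then show ?thesis
      using c coh trace_inner_hermitian[OF embed_projection_in_hermitian_over[OF F proj[OF PQ(2)]]]
      by (simp add: mult_nonneg_nonpos)
  qed
  moreover have "0 \<le> coherence us"
    if us: "list_all2 (\<lambda>u P. u \<in> embedded_projections F (rank P)) us Ps" for us :: "(complex^'m^'m) list"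
  proof (rule coherence_nonneg[OF F])
    have "\<exists>P. orth_projection F P \<and> u = embed_projection P" if "u \<in> set us" for u
      using us that by (auto simp: list_all2_conv_all_nth in_set_conv_nth embedded_projections_def)
    then show "set us \<subseteq> hermitian_over F" and "\<And>u. u \<in> set us \<Longrightarrow> mat 1 \<bullet> u = 0"
      using embed_projection_in_hermitian_over[OF F] mat_1_orthogonal_embed_projection by fast+
  qed (use us len in \<open>auto dest: list_all2_lengthD\<close>)
  moreover have "list_all2 (\<lambda>u P. u \<in> embedded_projections F (rank P)) ?es Ps"
    using proj by (auto simp: list_all2_conv_all_nth embedded_projections_def)
  ultimately show ?thesis
    using pack rank by (fastforce simp: optimally_spread_def is_arg_min_def)
qed

section \<open>Coordinate projections\<close>

lemma coord_projection_entry: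
  "coord_projection b J $ i $ k = (\<Sum>j\<in>J. b j $ i * cnj (b j $ k))"
  by (simp add: coord_projection_def outer_product_def)

lemma cinner_commute: "cinner x y = cnj (cinner y x)"
  by (simp add: cinner_def mult.commute)

lemma coord_projection_mult_entry:
  "(coord_projection b J ** coord_projection b' J') $ i $ k =
    (\<Sum>j\<in>J. \<Sum>j'\<in>J'. cinner (b' j') (b j) * (b j $ i * cnj (b' j' $ k)))"
proof -
  have "(coord_projection b J ** coord_projection b' J') $ i $ k =
      (\<Sum>p\<in>UNIV. \<Sum>j\<in>J. \<Sum>j'\<in>J'. (b j $ i * cnj (b j $ p)) * (b' j' $ p * cnj (b' j' $ k)))"
    by (simp add: matrix_matrix_mult_def coord_projection_entry sum_product)
  also have "\<dots> = (\<Sum>j\<in>J. \<Sum>j'\<in>J'. \<Sum>p\<in>UNIV. (b j $ i * cnj (b j $ p)) * (b' j' $ p * cnj (b' j' $ k)))"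
    by (rule trans[OF sum.swap], rule sum.cong[OF refl], rule sum.swap)
  finally show ?thesis
    by (simp add: cinner_def sum_distrib_left mult_ac)
qed

lemma coord_projection_mult_same_basis:
  assumes "orthonormal_basis F b"
  shows "coord_projection b J ** coord_projection b J' = coord_projection b (J \<inter> J')"
proof -
  have "(coord_projection b J ** coord_projection b J') $ i $ k = coord_projection b (J \<inter> J') $ i $ k" for i k
  proof -
    have "(coord_projection b J ** coord_projection b J') $ i $ k =
        (\<Sum>j\<in>J. \<Sum>j'\<in>J'. if j' = j then b j $ i * cnj (b j $ k) else 0)"
      unfolding coord_projection_mult_entry
      by (intro sum.cong refl) (use assms in \<open>auto simp: orthonormal_basis_def\<close>)
    also have "\<dots> = (\<Sum>j\<in>J \<inter> J'. b j $ i * cnj (b j $ k))"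
      by (simp add: sum.inter_restrict)
    finally show ?thesis by (simp add: coord_projection_entry)
  qed
  then show ?thesis by (simp add: vec_eq_iff)
qed

lemma trace_coord_projection:
  assumes "orthonormal_basis F b"
  shows "trace (coord_projection b J) = of_nat (card J)"
proof -
  have "trace (coord_projection b J) = (\<Sum>j\<in>J. cinner (b j) (b j))"
    unfolding trace_def coord_projection_entry cinner_def by (rule sum.swap)
  also have "\<dots> = of_nat (card J)" using assms by (simp add: orthonormal_basis_def)
  finally show ?thesis .
qed

lemma orth_projection_coord_projection:
  assumes F: "scalar_field F" and b: "orthonormal_basis F b"
  shows "orth_projection F (coord_projection b J)"
  unfolding orth_projection_def
proof (intro conjI)
  have "b j $ i * cnj (b j $ k) \<in> F" for i j k
    using F b by (auto simp: scalar_field_def orthonormal_basis_def vectors_over_def Reals_cnj_iff[THEN iffD1] intro!: Reals_mult)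
  then show "coord_projection b J \<in> matrices_over F"
    using F by (auto simp: matrices_over_def coord_projection_entry scalar_field_def intro!: sum_in_Reals)
  show "coord_projection b J ** coord_projection b J = coord_projection b J"
    using coord_projection_mult_same_basis[OF b, of J J] by simp
  show "ctranspose (coord_projection b J) = coord_projection b J"
    by (simp add: ctranspose_def map_matrix_def transpose_def vec_eq_iff coord_projection_entry mult.commute)
qed

lemma rank_coord_projection:
  assumes "orthonormal_basis F b"
  shows "rank (coord_projection b J) = card J"
proof -
  have "(of_nat (rank (coord_projection b J)) :: complex) = of_nat (card J)"
    using trace_idempotent_eq_rank[of "coord_projection b J"] coord_projection_mult_same_basis[OF assms, of J J]
      trace_coord_projection[OF assms, of J] by simp
  then show ?thesis by (simp only: of_nat_eq_iff)
qed

text \<open>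
  Orthonormality says that the matrix of basis vectors has its adjoint as a left inverse, and for
  square matrices a left inverse is a right inverse.
\<close>
lemma coord_projection_UNIV:
  assumes "orthonormal_basis F b"
  shows "coord_projection b UNIV = mat 1"
proof -
  define U where "U = (\<chi> i j. b j $ i)"
  have "ctranspose U ** U = mat 1"
    using assms
    by (simp add: vec_eq_iff matrix_matrix_mult_def ctranspose_def map_matrix_def transpose_def U_def mat_def
        orthonormal_basis_def cinner_def mult.commute[of "cnj _"])
  then have "U ** ctranspose U = mat 1" by (simp only: matrix_left_right_inverse)
  moreover have "U ** ctranspose U = coord_projection b UNIV"
    by (simp add: vec_eq_iff matrix_matrix_mult_def ctranspose_def map_matrix_def transpose_def U_def
        coord_projection_entry)
  ultimately show ?thesis by simp
qed

lemma trace_inner_coord_projection_same_basis: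
  assumes "orthonormal_basis F b"
  shows "trace_inner (coord_projection b J) (coord_projection b J') = card (J \<inter> J')"
  using assms by (simp add: trace_inner_def coord_projection_mult_same_basis trace_coord_projection)

lemma trace_inner_coord_projection_unbiased:
  fixes b b' :: "'m::finite \<Rightarrow> complex^'m"
  assumes "mutually_unbiased b b'"
  shows "trace_inner (coord_projection b J) (coord_projection b' J') =
    real (card J) * real (card J') / real CARD('m)"
proof -
  have "trace (coord_projection b J ** coord_projection b' J') =
      (\<Sum>j\<in>J. \<Sum>j'\<in>J'. cinner (b' j') (b j) * cinner (b j) (b' j'))"
    unfolding trace_def coord_projection_mult_entry
    by (rule trans[OF sum.swap], rule sum.cong[OF refl], rule trans[OF sum.swap])
      (simp add: cinner_def sum_distrib_left)
  also have "\<dots> = (\<Sum>j\<in>J. \<Sum>j'\<in>J'. of_real ((cmod (cinner (b j) (b' j')))\<^sup>2))"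
    by (subst (1) cinner_commute) (simp only: complex_norm_square mult.commute)
  also have "\<dots> = of_real (real (card J) * real (card J') / real CARD('m))"
    using assms by (simp add: mutually_unbiased_def)
  finally show ?thesis by (simp only: trace_inner_def Re_complex_of_real)
qed

text \<open>
  Double counting: each \<open>b\<^sub>j b\<^sub>j\<^sup>*\<close> occurs once for each block that contains \<open>j\<close>, and all of them
  together sum to the identity.
\<close>
lemma sum_coord_projection_regular:
  fixes b :: "'m::finite \<Rightarrow> complex^'m"
  assumes b: "orthonormal_basis F b" and r: "\<And>j. card {J \<in> S. j \<in> J} = r"
  shows "(\<Sum>J\<in>S. coord_projection b J) = real r *\<^sub>R mat 1"
proof -
  have "(\<Sum>J\<in>S. coord_projection b J) = (\<Sum>J\<in>S. \<Sum>j\<in>UNIV. if j \<in> J then outer_product (b j) (b j) else 0)"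
    by (simp add: coord_projection_def sum.If_cases)
  also have "\<dots> = (\<Sum>j\<in>UNIV. \<Sum>J\<in>S. if j \<in> J then outer_product (b j) (b j) else 0)"
    by (rule sum.swap)
  also have "\<dots> = (\<Sum>j\<in>UNIV. real r *\<^sub>R outer_product (b j) (b j))"
    by (simp add: sum.If_cases r sum_constant_scaleR Int_def del: sum_constant)
  also have "\<dots> = real r *\<^sub>R coord_projection b UNIV"
    by (simp add: coord_projection_def scaleR_sum_right)
  finally show ?thesis by (simp add: coord_projection_UNIV[OF b])
qed

section \<open>Block designs and the packing\<close>

text \<open>
  Positivity matters for the tightness constant: a point of some nonempty block lies in at least
  one block, and by regularity so does every other point.
\<close>
lemma block_design_replication:
  assumes S: "block_design l lam S" and l: "0 < l"
  shows "\<exists>r. 0 < r \<and> (\<forall>j. card {J \<in> S. j \<in> J} = r)"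
proof -
  obtain r where r: "\<And>j. card {J \<in> S. j \<in> J} = r"
    using S by (auto simp: block_design_def t_block_design_def)
  obtain J where J: "J \<in> S" "card J = l"
    using S by (auto simp: block_design_def t_block_design_def)
  then have "J \<noteq> {}" using l by auto
  then obtain j where "j \<in> J" by blast
  with J have "0 < card {J \<in> S. j \<in> J}" by (auto simp: card_gt_0_iff)
  then show ?thesis using r by auto
qed

theorem theorem6p10:
  fixes F :: "complex set"
    and K :: "'k set"
    and B :: "'k \<Rightarrow> 'm::finite \<Rightarrow> complex ^ 'm"
    and s :: nat
    and S :: "nat \<Rightarrow> 'm set set"
    and l lam :: "nat \<Rightarrow> nat"
    and A :: "nat \<Rightarrow> 'k set"
    and \<P> :: "nat \<Rightarrow> (complex ^ 'm ^ 'm) set"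
    and Ps :: "(complex ^ 'm ^ 'm) list"
  assumes "scalar_field F"
    and "finite K" and "mutually_unbiased_bases F K B"
    and "s \<le> card K"
    and "\<And>i. i \<in> {1..s} \<Longrightarrow> block_design (l i) (lam i) (S i)"
    and "inj_on l {1..s}"
    and "\<And>i. i \<in> {1..s} \<Longrightarrow> 1 \<le> l i \<and> l i \<le> CARD('m) - 1"
    and "\<And>i. i \<in> {1..s} \<Longrightarrow> A i \<noteq> {}"
    and "disjoint_family_on A {1..s}"
    and "(\<Union>i\<in>{1..s}. A i) = K"
    and "\<And>i. i \<in> {1..s} \<Longrightarrow> \<P> i = {coord_projection (B k) J | k J. k \<in> A i \<and> J \<in> S i}"
    and "\<And>i. i \<in> {1..s} \<Longrightarrow> cohesive ((real (l i))\<^sup>2 / real CARD('m)) (S i)"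
    and "(\<Sum>i\<in>{1..s}. card (S i) * card (A i)) > packing_dim F CARD('m) + 1"
    and "distinct Ps" and "set Ps = (\<Union>i\<in>{1..s}. \<P> i)"
  shows "packing F Ps \<and> tight Ps \<and> optimally_spread F Ps \<and> mixture Ps = s"
proof -
  note F = assms(1) and \<P> = assms(11)
  \<comment> \<open>The packing is indexed by the triples of a design, a basis assigned to it and a block.\<close>
  define \<Omega> where "\<Omega> = (SIGMA i:{1..s}. A i \<times> S i)"
  define p where "p = (\<lambda>(i :: nat, k, J). coord_projection (B k) J)"
  have AK: "k \<in> K" if "i \<in> {1..s}" "k \<in> A i" for i k using assms(10) that by blast
  have finA: "finite (A i)" if "i \<in> {1..s}" for i using AK[OF that] assms(2) by (meson finite_subset subsetI)
  have onb: "orthonormal_basis F (B k)" if "i \<in> {1..s}" "k \<in> A i" for i k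
    using assms(3) AK that by (auto simp: mutually_unbiased_bases_def)
  have card_block: "card J = l i" if "i \<in> {1..s}" "J \<in> S i" for i J
    using assms(5)[OF that(1)] that(2) by (auto simp: block_design_def t_block_design_def)
  have S_ne: "S i \<noteq> {}" if "i \<in> {1..s}" for i
    using assms(5)[OF that] by (auto simp: block_design_def t_block_design_def)
  have l_bounds: "0 < l i" "l i < CARD('m)" if "i \<in> {1..s}" for i
    using assms(7)[OF that] by linarith+
  have same_index: "i = i'" if "i \<in> {1..s}" "i' \<in> {1..s}" "k \<in> A i" "k \<in> A i'" for i i' k
    using assms(9) that unfolding disjoint_family_on_def by blast
  have set_Ps: "set Ps = p ` \<Omega>"
    unfolding assms(15) using \<P> by (force simp: p_def \<Omega>_def)
  have rank_p: "rank (p (i, k, J)) = l i" if "(i, k, J) \<in> \<Omega>" for i k J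
    using that rank_coord_projection[OF onb] card_block by (auto simp: p_def \<Omega>_def)

  have inner_other: "trace_inner (p (i, k, J)) (p (i', k', J')) = real (l i) * real (l i') / real CARD('m)"
    if "(i, k, J) \<in> \<Omega>" "(i', k', J') \<in> \<Omega>" "k \<noteq> k'" for i k J i' k' J'
  proof -
    have "mutually_unbiased (B k) (B k')"
      using assms(3) that(3) AK[of i k] AK[of i' k'] that(1,2)
      by (auto simp: mutually_unbiased_bases_def pairwise_def \<Omega>_def)
    from trace_inner_coord_projection_unbiased[OF this] show ?thesis
      using that card_block by (auto simp: p_def \<Omega>_def)
  qed
  have inner_same: "trace_inner (p (i, k, J)) (p (i, k, J')) = real (card (J \<inter> J'))"
    if "(i, k, J) \<in> \<Omega>" for i k J J'
    using that trace_inner_coord_projection_same_basis[OF onb] by (auto simp: p_def \<Omega>_def)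

  \<comment> \<open>The rank determines the design. Within a design, the inner product of two copies of the same
    projection is the rank \<open>l\<close>, whereas distinct bases would give \<open>l\<^sup>2 / m\<close>, which is smaller because \<open>l < m\<close>,
    and distinct blocks would give the size of their intersection, which is less than \<open>l\<close> as well.\<close>
  have inj: "inj_on p \<Omega>"
  proof (rule inj_onI)
    fix x x' assume "x \<in> \<Omega>" "x' \<in> \<Omega>" and eq: "p x = p x'"
    moreover obtain i k J i' k' J' where xx: "x = (i, k, J)" "x' = (i', k', J')"
      by (cases x, cases x') auto
    ultimately have x: "(i, k, J) \<in> \<Omega>" and x': "(i', k', J') \<in> \<Omega>" by simp_all
    have i: "i \<in> {1..s}" "k \<in> A i" "J \<in> S i" and i': "i' \<in> {1..s}" "k' \<in> A i'" "J' \<in> S i'"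
      using x x' by (auto simp: \<Omega>_def)
    have "l i = l i'" using eq rank_p x x' xx by metis
    then have "i = i'" using i(1) i'(1) by (rule inj_onD[OF assms(6)])
    have self: "trace_inner (p (i, k, J)) (p (i', k', J')) = real (l i)"
      using inner_same[OF x, of J] eq xx card_block[OF i(1,3)] by simp
    have "k = k'"
    proof (rule ccontr)
      assume "k \<noteq> k'"
      from inner_other[OF x x' this] self \<open>i = i'\<close> have "l i = CARD('m)"
        using l_bounds[OF i(1)] by (simp add: field_simps)
      then show False using l_bounds[OF i(1)] by simp
    qed
    then have "card (J \<inter> J') = l i" using inner_same[OF x, of J'] self \<open>i = i'\<close> by simp
    then have "J = J'"
      using card_block[OF i(1,3)] card_block[OF i'(1,3)] \<open>i = i'\<close>
        card_subset_eq[of J "J \<inter> J'"] card_subset_eq[of J' "J \<inter> J'"] by auto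
    then show "x = x'" using xx \<open>i = i'\<close> \<open>k = k'\<close> by auto
  qed

  have pack: "packing F Ps"
    using orth_projection_coord_projection[OF F onb] by (auto simp: packing_def set_Ps \<Omega>_def p_def)

  have "length Ps = card \<Omega>"
    using assms(14) by (simp add: distinct_card[symmetric] set_Ps card_image[OF inj])
  also have "\<dots> = (\<Sum>i\<in>{1..s}. card (S i) * card (A i))"
    unfolding \<Omega>_def using finA by (subst card_SigmaI) (auto simp: card_cartesian_product mult.commute)
  finally have len: "length Ps > packing_dim F CARD('m) + 1" using assms(13) by simp

  have spread: "optimally_spread F Ps"
  proof (rule optimally_spread_if_pairwise_obtuse[OF F pack _ len assms(14)])
    show "1 \<le> rank P \<and> rank P \<le> CARD('m) - 1" if "P \<in> set Ps" for P
      using that rank_p assms(7) by (auto simp: set_Ps \<Omega>_def)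
    fix P Q assume "P \<in> set Ps" "Q \<in> set Ps" "P \<noteq> Q"
    then obtain i k J i' k' J' where x: "(i, k, J) \<in> \<Omega>" "(i', k', J') \<in> \<Omega>"
      and PQ: "P = p (i, k, J)" "Q = p (i', k', J')"
      by (auto simp: set_Ps)
    have i: "i \<in> {1..s}" "i' \<in> {1..s}" "J \<in> S i" "J' \<in> S i'" using x by (auto simp: \<Omega>_def)
    have "trace_inner P Q \<le> real (l i) * real (l i') / real CARD('m)"
    proof (cases "k = k'")
      \<comment> \<open>A basis is assigned to only one design, so cohesiveness of that design applies.\<close>
      case True
      then have "i = i'" using same_index x by (auto simp: \<Omega>_def)
      with True PQ \<open>P \<noteq> Q\<close> have "J \<noteq> J'" by auto
      then have "real (card (J \<inter> J')) \<le> (real (l i))\<^sup>2 / real CARD('m)"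
        using assms(12)[OF i(1)] i \<open>i = i'\<close> by (auto simp: cohesive_def)
      then show ?thesis
        using inner_same[OF x(1), of J'] PQ True \<open>i = i'\<close> by (simp add: power2_eq_square)
    next
      case False
      then show ?thesis using inner_other[OF x] PQ by simp
    qed
    then show "trace_inner P Q \<le> real (rank P) * real (rank Q) / real CARD('m)"
      using PQ rank_p x by simp
  qed

  have s: "{1..s} \<noteq> {}" using assms(13) by (intro notI) simp
  have tight: "tight Ps"
  proof -
    have "\<exists>r. \<forall>i\<in>{1..s}. 0 < r i \<and> (\<forall>j. card {J \<in> S i. j \<in> J} = r i)"
      by (intro bchoice ballI block_design_replication[OF assms(5)] l_bounds)
    then obtain r where r: "\<And>i. i \<in> {1..s} \<Longrightarrow> 0 < r i"
        "\<And>i j. i \<in> {1..s} \<Longrightarrow> card {J \<in> S i. j \<in> J} = r i"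
      by blast
    have "sum_list Ps = \<Sum>(set Ps)" using assms(14) by (simp add: sum_list_distinct_conv_sum_set[where f = id, simplified])
    also have "\<dots> = (\<Sum>x\<in>\<Omega>. p x)" using inj by (simp add: set_Ps sum.reindex)
    also have "\<dots> = (\<Sum>i\<in>{1..s}. \<Sum>k\<in>A i. \<Sum>J\<in>S i. coord_projection (B k) J)"
      unfolding \<Omega>_def p_def using finA by (simp add: sum.Sigma sum.cartesian_product split_def)
    also have "\<dots> = (\<Sum>i\<in>{1..s}. \<Sum>k\<in>A i. real (r i) *\<^sub>R mat 1)"
      by (intro sum.cong refl sum_coord_projection_regular[OF onb]) (use r in auto)
    also have "\<dots> = (\<Sum>i\<in>{1..s}. real (card (A i)) * real (r i)) *\<^sub>R mat 1"
      by (simp add: scaleR_sum_left sum_constant_scaleR del: sum_constant)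
    finally have "sum_list Ps = \<dots>" .
    moreover have "0 < (\<Sum>i\<in>{1..s}. real (card (A i)) * real (r i))"
      using s r(1) finA assms(8) by (intro sum_pos) (auto simp: card_gt_0_iff)
    ultimately show ?thesis unfolding tight_def by blast
  qed

  have "rank ` set Ps = l ` {1..s}"
  proof -
    have "(\<lambda>x. rank (p x)) ` \<Omega> = (\<lambda>x. l (fst x)) ` \<Omega>"
      using rank_p by (intro image_cong) auto
    also have "\<dots> = l ` fst ` \<Omega>" by (simp add: image_image)
    also have "fst ` \<Omega> = {1..s}" using S_ne assms(8) by (force simp: \<Omega>_def image_iff)
    finally show ?thesis by (simp add: set_Ps image_image)
  qed
  then have "mixture Ps = s" using assms(6) by (simp add: mixture_def card_image)
  with pack tight spread show ?thesis by blast
qed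

end
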